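(* Let $H\in\mathbb{R}^{n\times n}$ be symmetric with positive diagonal, $D=\operatorname{diag}(H_{11},\dots,H_{nn})$, $A=D^{-1}|H-D|$ (entrywise absolute value), $\rho(A)<1$, $x^*\in\mathbb{R}^n$, $f(x)=\tfrac12(x-x^* )^\top H(x-x^* )$, and let $x^*\in\mathcal{B}(c_0,r^{\mathrm{init}})$ with $c_0\in\mathbb{R}^n$, $r^{\mathrm{init}}\in\mathbb{R}^n_{>0}$. Let $\xi\in\mathbb{R}^n$, $\xi\ge0$, be fixed, and suppose that at each step the gradient answer $g_k$ satisfies $|g_{k,i}-\partial_if(c_k)|\le H_{ii}\xi_i$ for all $i$. Run the rule $$t_k=\min\{r_k,Ar_k+\xi\},\quad h_k=\tfrac12(r_k-t_k),\quad r_{k+1}=\tfrac12(r_k+t_k),\quad c_{k+1}=c_k-h_k\odot s_k,\quad r_0=r^{\mathrm{init}},$$ where $s_k\in\{-1,+1\}^n$, $s_{k,i}=\operatorname{sign}g_{k,i}$ if $g_{k,i}\neq0$, and $s_{k,i}$ is arbitrary otherwise. Then: (i) $x^*\in\mathcal{B}(c_k,r_k)$ and $\mathcal{B}(c_{k+1},r_{k+1})\subseteq\mathcal{B}(c_k,r_k)$ for all $k$; (ii) the half-sizes $r_k$ converge to the unique solution $v\in[0,r^{\mathrm{init}}]$ of $$v=\min\{r^{\mathrm{init}},Av+\xi\};$$ (iii) $$0\le r_k-v\le\Bigl(\frac{I+A}{2}\Bigr)^k(r^{\mathrm{init}}-v)\quad\text{for all }k,\qquad v\le(I-A)^{-1}\xi;$$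 (iv) the centres $c_k$ converge to some $c_\infty$ and $|c_\infty-x^*|\le v$; (v) if $r^{\mathrm{init}}\ge(I-A)^{-1}\xi$, then $v=(I-A)^{-1}\xi$.
   Context: Vector inequalities, minima, absolute values and products $\odot$ are componentwise. $\rho$ is the spectral radius. $\mathcal{B}(c,r)=\{x:|x_i-c_i|\le r_i\ \forall i\}$. $[0,r^{\mathrm{init}}]$ denotes $\{z\in\mathbb{R}^n:0\le z\le r^{\mathrm{init}}\}$. *)

theory Defs
  imports "HOL-Analysis.Analysis"
begin

text \<open>
  On \<open>real ^ 'n\<close> the library operations \<open>\<le>\<close>, \<open>inf\<close>, \<open>\<bar>_\<bar>\<close> and \<open>*\<close> are componentwise, and on
  \<open>real ^ 'n ^ 'n\<close> so is \<open>\<bar>_\<bar>\<close>; they are used as such below. The polymorphic \<open>min\<close> is not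
  componentwise for this partial order (hence \<open>inf\<close>), and \<open>A ^ k\<close> is the entrywise power (hence
  \<open>matrix_power\<close>).
\<close>

definition diagonal_part :: "real ^ 'n ^ 'n \<Rightarrow> real ^ 'n ^ 'n" where
  "diagonal_part H = (\<chi> i j. if i = j then H $ i $ i else 0)"

primrec matrix_power :: "'a::semiring_1 ^ 'n ^ 'n \<Rightarrow> nat \<Rightarrow> 'a ^ 'n ^ 'n" where
  "matrix_power A 0 = mat 1"
| "matrix_power A (Suc k) = A ** matrix_power A k"

definition matrix_eigenvalue :: "'a::field ^ 'n ^ 'n \<Rightarrow> 'a \<Rightarrow> bool" where
  "matrix_eigenvalue A \<mu> \<longleftrightarrow> (\<exists>v. v \<noteq> 0 \<and> A *v v = \<mu> *s v)"

text \<open>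
  The eigenvalues range over the complex numbers. Their set is finite and nonempty, so the
  supremum is a maximum.
\<close>

definition spectral_radius :: "real ^ 'n ^ 'n \<Rightarrow> real" where
  "spectral_radius A =
     (SUP \<mu> \<in> {\<mu>. matrix_eigenvalue (\<chi> i j. complex_of_real (A $ i $ j)) \<mu>}. cmod \<mu>)"

definition partial_derivative :: "'n \<Rightarrow> (real ^ 'n \<Rightarrow> real) \<Rightarrow> real ^ 'n \<Rightarrow> real" where
  "partial_derivative i f x = deriv (\<lambda>\<tau>. f (x + \<tau> *\<^sub>R axis i 1)) 0"

definition box_around :: "real ^ 'n \<Rightarrow> real ^ 'n \<Rightarrow> (real ^ 'n) set" where
  "box_around c r = {x. \<forall>i. \<bar>x $ i - c $ i\<bar> \<le> r $ i}"

end

theory Submission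
  imports Defs
begin

text \<open>
  Everything rests on one fact about a nonnegative matrix \<open>A\<close> with \<open>\<rho>(A) < 1\<close>: a vector
  \<open>z \<ge> 0\<close> with \<open>z \<le> A z\<close> is zero (\<open>subinvariant_vector_eq_0\<close>). Applied to the absolute value
  of a kernel vector it makes \<open>I - A\<close> invertible; applied to a negative part it makes the
  inverse monotone; applied to \<open>\<bar>v - w\<bar>\<close> it shows that \<open>v = min {R, A v + \<xi>}\<close> has at most one
  solution.

  The half-sizes \<open>r k\<close> decrease and stay nonnegative, so they converge. Passing to the limit in
  the recursion only gives \<open>v \<le> A v + \<xi>\<close>; the missing half of the fixed point equation comes from
  the invariant \<open>min {R, A (r k) + \<xi>} \<le> r k\<close> (\<open>capped_image_le\<close>). The rate follows from
  \<open>r (k + 1) - v \<le> (I + A) / 2 * (r k - v)\<close>, iterated with the monotonicity of \<open>(I + A) / 2\<close>.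

  For the centres, put \<open>e = c k - x_star\<close>. The gradient is \<open>H e\<close>. If \<open>\<bar>e\<bar> \<le> r k\<close>, then
  \<open>(H e) $ i / H $ i $ i\<close> differs from \<open>e $ i\<close> by at most \<open>(A (r k)) $ i\<close>, and the noise adds at
  most \<open>\<xi> $ i\<close> to the difference. A gradient answer of sign \<open>s\<close> therefore
  excludes \<open>s * e $ i < - t k $ i\<close>, and the rule cuts off just the part of the box so excluded.
  The centre moves by exactly the amount by which the half-size shrinks, so the boxes are nested
  and \<open>c k + r k\<close> is decreasing and bounded below by \<open>x_star\<close>; this gives the convergence of the
  centres.
\<close>

section \<open>Nonnegative matrices of spectral radius below one\<close>

lemma matrix_vector_nth: "(A *v x) $ i = (\<Sum>j\<in>UNIV. A $ i $ j * x $ j)"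
  by (simp add: matrix_vector_mult_def)

lemma nonneg_matrix_nth: "0 \<le> (A :: real ^ 'n ^ 'm) \<Longrightarrow> 0 \<le> A $ i $ j"
  by (simp add: less_eq_vec_def)

lemma nonneg_matrix_vector_mono:
  fixes A :: "real ^ 'n ^ 'm"
  assumes "0 \<le> A" "x \<le> y"
  shows "A *v x \<le> A *v y"
  using assms
  by (auto simp: less_eq_vec_def matrix_vector_nth intro!: sum_mono mult_left_mono)

lemma nonneg_matrix_vector_nonneg:
  fixes A :: "real ^ 'n ^ 'm"
  assumes "0 \<le> A" "0 \<le> x"
  shows "0 \<le> A *v x"
  using nonneg_matrix_vector_mono[OF assms] by simp

lemma abs_vector_nth: "\<bar>x :: real ^ 'n\<bar> $ i = \<bar>x $ i\<bar>"
  by (simp add: abs_vec_def)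

lemma inf_vector_nth: "inf x (y :: real ^ 'n) $ i = min (x $ i) (y $ i)"
  by (simp add: inf_vec_def inf_min)

lemma abs_nonneg_matrix_vector_le:
  fixes A :: "real ^ 'n ^ 'm"
  assumes "0 \<le> A"
  shows "\<bar>A *v x\<bar> \<le> A *v \<bar>x\<bar>"
proof -
  have "\<bar>\<Sum>j\<in>UNIV. A $ i $ j * x $ j\<bar> \<le> (\<Sum>j\<in>UNIV. A $ i $ j * \<bar>x $ j\<bar>)" for i
    by (rule order.trans[OF sum_abs])
      (simp add: abs_mult nonneg_matrix_nth[OF assms])
  then show ?thesis
    by (simp add: less_eq_vec_def matrix_vector_nth abs_vector_nth)
qed

text \<open>
  Read off the eigenvalue equation in a coordinate where the eigenvector is largest. The bound
  makes the supremum in \<^const>\<open>spectral_radius\<close> meaningful.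
\<close>

lemma eigenvalue_cmod_le_entry_sum:
  fixes B :: "complex ^ 'n ^ 'n"
  assumes "matrix_eigenvalue B \<mu>"
  shows "cmod \<mu> \<le> (\<Sum>i\<in>UNIV. \<Sum>j\<in>UNIV. cmod (B $ i $ j))"
proof -
  obtain v where v: "v \<noteq> 0" "B *v v = \<mu> *s v"
    using assms by (auto simp: matrix_eigenvalue_def)
  obtain i where i: "\<And>j. cmod (v $ j) \<le> cmod (v $ i)"
  proof -
    have "Max (range (\<lambda>j. cmod (v $ j))) \<in> range (\<lambda>j. cmod (v $ j))"
      by (rule Max_in) auto
    then obtain i where "cmod (v $ i) = Max (range (\<lambda>j. cmod (v $ j)))"
      by (metis rangeE)
    then show thesis
      by (intro that[of i]) simp
  qed
  have pos: "cmod (v $ i) > 0"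
  proof (rule ccontr)
    assume "\<not> cmod (v $ i) > 0"
    then have "v $ j = 0" for j
      using i[of j] by (metis norm_le_zero_iff order.trans linorder_not_less)
    with v(1) show False
      by (simp add: vec_eq_iff)
  qed
  have "cmod \<mu> * cmod (v $ i) = cmod (\<Sum>j\<in>UNIV. B $ i $ j * v $ j)"
    using arg_cong[OF v(2), of "\<lambda>w. cmod (w $ i)"]
    by (simp add: matrix_vector_nth norm_mult)
  also have "\<dots> \<le> (\<Sum>j\<in>UNIV. cmod (B $ i $ j) * cmod (v $ i))"
    by (rule order.trans[OF norm_sum])
      (auto simp: norm_mult intro!: sum_mono mult_left_mono i)
  also have "\<dots> = (\<Sum>j\<in>UNIV. cmod (B $ i $ j)) * cmod (v $ i)"
    by (simp add: sum_distrib_right)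
  finally have "cmod \<mu> \<le> (\<Sum>j\<in>UNIV. cmod (B $ i $ j))"
    using pos by simp
  also have "\<dots> \<le> (\<Sum>i\<in>UNIV. \<Sum>j\<in>UNIV. cmod (B $ i $ j))"
    by (rule member_le_sum) (auto intro: sum_nonneg)
  finally show ?thesis .
qed

lemma real_eigenvalue_le_spectral_radius:
  fixes A :: "real ^ 'n ^ 'n"
  assumes "A *v x = \<mu> *\<^sub>R x" "x \<noteq> 0"
  shows "\<bar>\<mu>\<bar> \<le> spectral_radius A"
proof -
  let ?B = "\<chi> i j. complex_of_real (A $ i $ j)"
  let ?E = "{\<mu>. matrix_eigenvalue ?B \<mu>}"
  have "?B *v (\<chi> i. complex_of_real (x $ i)) = complex_of_real \<mu> *s (\<chi> i. complex_of_real (x $ i))"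
  proof (subst vec_eq_iff, intro allI)
    fix i
    have "(\<Sum>j\<in>UNIV. A $ i $ j * x $ j) = \<mu> * x $ i"
      using arg_cong[OF assms(1), of "\<lambda>w. w $ i"] by (simp add: matrix_vector_nth)
    then have "complex_of_real (\<Sum>j\<in>UNIV. A $ i $ j * x $ j) = complex_of_real (\<mu> * x $ i)"
      by simp
    then show "(?B *v (\<chi> i. complex_of_real (x $ i))) $ i
        = (complex_of_real \<mu> *s (\<chi> i. complex_of_real (x $ i))) $ i"
      by (simp add: matrix_vector_nth)
  qed
  moreover have "(\<chi> i. complex_of_real (x $ i)) \<noteq> 0"
    using assms(2) by (auto simp: vec_eq_iff)
  ultimately have "complex_of_real \<mu> \<in> ?E"
    unfolding matrix_eigenvalue_def by blast
  moreover have "bdd_above (cmod ` ?E)"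
    by (rule bdd_aboveI2) (use eigenvalue_cmod_le_entry_sum in blast)
  ultimately have "cmod (complex_of_real \<mu>) \<le> spectral_radius A"
    unfolding spectral_radius_def by (rule cSUP_upper)
  then show ?thesis
    by simp
qed

text \<open>
  This is the part of Perron--Frobenius theory on which everything rests. If a nonzero
  \<open>z \<ge> 0\<close> had \<open>z \<le> A z\<close>, then the vectors \<open>x\<close> of the standard simplex with \<open>x \<le> A x\<close> would form a
  nonempty compact convex set, mapped into itself by \<open>x \<mapsto> A x / \<Sum>(A x)\<close>. A fixed point, which
  Brouwer's theorem supplies, is an eigenvector whose eigenvalue \<open>\<Sum>(A x)\<close> is at least
  \<open>\<Sum>x = 1\<close>.
\<close>

lemma subinvariant_vector_eq_0:
  fixes A :: "real ^ 'n ^ 'n"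
  assumes A: "0 \<le> A" and rho: "spectral_radius A < 1"
    and z: "0 \<le> z" "z \<le> A *v z"
  shows "z = 0"
proof (rule ccontr)
  assume "z \<noteq> 0"
  define total :: "real ^ 'n \<Rightarrow> real" where "total x = (\<Sum>i\<in>UNIV. x $ i)" for x
  define K where "K = {x. 0 \<le> x \<and> total x = 1 \<and> x \<le> A *v x}"
  define F where "F x = (1 / total (A *v x)) *\<^sub>R (A *v x)" for x
  have total_mono: "total x \<le> total y" if "x \<le> y" for x y
    using that by (auto simp: total_def less_eq_vec_def intro: sum_mono)
  have total_scale: "total (a *\<^sub>R x) = a * total x" for a x
    by (simp add: total_def sum_distrib_left)
  have total_add: "total (x + y) = total x + total y" for x y
    by (simp add: total_def sum.distrib)
  have cont_A [continuous_intros]: "continuous_on S (\<lambda>x. A *v x)" for S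
    by (rule linear_continuous_on) (rule matrix_vector_mul_bounded_linear)
  have cont_total: "continuous_on S total" for S
    unfolding total_def by (intro continuous_intros)
  have total_ge_1: "1 \<le> total (A *v x)" if "x \<in> K" for x
    using that total_mono by (fastforce simp: K_def)
  have "K \<noteq> {}"
  proof -
    have pos: "total z > 0"
    proof -
      obtain i where "z $ i \<noteq> 0"
        using \<open>z \<noteq> 0\<close> by (auto simp: vec_eq_iff)
      then show ?thesis
        unfolding total_def using z(1) by (intro sum_pos2[of _ i]) (auto simp: less_eq_vec_def less_le)
    qed
    then have "(1 / total z) *\<^sub>R z \<in> K"
      using z by (auto simp: K_def total_scale less_eq_vec_def matrix_vector_mult_scaleR divide_right_mono)
    then show ?thesis
      by blast
  qed
  moreover have "compact K"
  proof -
    have "closed K"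
    proof -
      have "K = {0..} \<inter> {x. total x = 1} \<inter> {x. \<forall>i. x $ i \<le> (A *v x) $ i}"
        by (auto simp: K_def less_eq_vec_def)
      moreover have "closed {x. total x = 1}"
        by (intro closed_Collect_eq continuous_intros cont_total)
      moreover have "closed {x. \<forall>i. x $ i \<le> (A *v x) $ i}"
        by (intro closed_Collect_all closed_Collect_le continuous_intros)
      moreover have "closed {0 :: real ^ 'n..}"
      proof -
        have "{0 :: real ^ 'n..} = {x. \<forall>i. 0 \<le> x $ i}"
          by (auto simp: less_eq_vec_def)
        then show ?thesis
          by (simp only:) (intro closed_Collect_all closed_Collect_le continuous_intros)
      qed
      ultimately show ?thesis
        by auto
    qed
    moreover have "bounded K"
    proof (rule boundedI)
      fix x assume x: "x \<in> K"
      have "norm x \<le> (\<Sum>i\<in>UNIV. \<bar>x $ i\<bar>)"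
        by (rule norm_le_l1_cart)
      also have "\<dots> = 1"
        using x by (simp add: K_def total_def less_eq_vec_def)
      finally show "norm x \<le> 1" .
    qed
    ultimately show ?thesis
      by (simp add: compact_eq_bounded_closed)
  qed
  moreover have "convex K"
  proof (rule convexI)
    fix x y and a b :: real
    assume xy: "x \<in> K" "y \<in> K" and ab: "0 \<le> a" "0 \<le> b" "a + b = 1"
    have "a *\<^sub>R x + b *\<^sub>R y \<le> a *\<^sub>R (A *v x) + b *\<^sub>R (A *v y)"
      using xy ab by (auto simp: K_def less_eq_vec_def intro!: add_mono mult_left_mono)
    then show "a *\<^sub>R x + b *\<^sub>R y \<in> K"
      using xy ab
      by (auto simp: K_def less_eq_vec_def total_scale total_add matrix_vector_right_distrib
          matrix_vector_mult_scaleR)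
  qed
  moreover have "continuous_on K F"
    unfolding F_def
    by (intro continuous_intros continuous_on_compose2[OF cont_total[of UNIV]])
      (use total_ge_1 in fastforce)+
  moreover have "F x \<in> K" if x: "x \<in> K" for x
  proof -
    let ?m = "total (A *v x)"
    have m: "1 \<le> ?m"
      by (rule total_ge_1[OF x])
    have "A *v x \<le> A *v (A *v x)"
      using x by (intro nonneg_matrix_vector_mono[OF A]) (simp add: K_def)
    then have "F x \<le> A *v F x"
      using m by (simp add: F_def less_eq_vec_def matrix_vector_mult_scaleR divide_right_mono)
    moreover have "0 \<le> F x"
      using m x nonneg_matrix_vector_nonneg[OF A, of x]
      by (simp add: F_def K_def less_eq_vec_def)
    moreover have "total (F x) = 1"
      using m by (simp add: F_def total_scale)
    ultimately show ?thesis
      by (simp add: K_def)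
  qed
  ultimately obtain x where x: "x \<in> K" "F x = x"
    using brouwer[of K F] by blast
  have m: "1 \<le> total (A *v x)"
    by (rule total_ge_1[OF x(1)])
  have "A *v x = total (A *v x) *\<^sub>R F x"
    using m by (simp add: F_def)
  then have "A *v x = total (A *v x) *\<^sub>R x"
    using x(2) by simp
  moreover have "x \<noteq> 0"
    using x(1) by (auto simp: K_def total_def)
  ultimately have "\<bar>total (A *v x)\<bar> \<le> spectral_radius A"
    by (rule real_eigenvalue_le_spectral_radius)
  then show False
    using m rho by simp
qed

text \<open>The negative part \<open>z\<close> of \<open>x\<close> satisfies \<open>z \<le> A z\<close>, so it vanishes.\<close>

lemma superinvariant_vector_nonneg:
  fixes A :: "real ^ 'n ^ 'n"
  assumes A: "0 \<le> A" and rho: "spectral_radius A < 1" and x: "A *v x \<le> x"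
  shows "0 \<le> x"
proof -
  define z where "z = sup (- x) 0"
  have z: "- x \<le> z" "0 \<le> z"
    by (simp_all add: z_def)
  have "- x \<le> A *v (- x)"
    using x by (simp add: less_eq_vec_def matrix_vector_nth sum_negf)
  also have "\<dots> \<le> A *v z"
    by (rule nonneg_matrix_vector_mono[OF A z(1)])
  finally have "z \<le> A *v z"
    using nonneg_matrix_vector_nonneg[OF A z(2)] by (simp add: z_def)
  then have "z = 0"
    by (rule subinvariant_vector_eq_0[OF A rho z(2)])
  then show ?thesis
    using z(1) by simp
qed

lemma invertible_mat_1_minus:
  fixes A :: "real ^ 'n ^ 'n"
  assumes A: "0 \<le> A" and rho: "spectral_radius A < 1"
  shows "invertible (mat 1 - A)"
proof -
  have "x = 0" if "(mat 1 - A) *v x = 0" for x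
  proof -
    have eq: "A *v x = x"
      using that by (simp add: matrix_vector_mult_diff_rdistrib)
    have "\<bar>x\<bar> \<le> A *v \<bar>x\<bar>"
      using abs_nonneg_matrix_vector_le[OF A, of x] eq by simp
    then have "\<bar>x\<bar> = 0"
      by (intro subinvariant_vector_eq_0[OF A rho]) (auto simp: less_eq_vec_def abs_vector_nth)
    then show ?thesis
      by (simp add: vec_eq_iff abs_vector_nth)
  qed
  then show ?thesis
    by (simp add: invertible_left_inverse matrix_left_invertible_ker)
qed

lemma matrix_mult_matrix_inv:
  assumes "invertible B"
  shows "B ** matrix_inv B = mat 1"
proof -
  have "B ** matrix_inv B = mat 1 \<and> matrix_inv B ** B = mat 1"
    unfolding matrix_inv_def by (rule someI_ex) (use assms in \<open>simp add: invertible_def\<close>)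
  then show ?thesis
    by simp
qed

lemma matrix_inv_mat_1_minus_eq:
  fixes A :: "real ^ 'n ^ 'n"
  assumes "invertible (mat 1 - A)" "u = matrix_inv (mat 1 - A) *v \<xi>"
  shows "u = A *v u + \<xi>"
proof -
  have "(mat 1 - A) *v u = \<xi>"
    using assms by (simp add: matrix_vector_mul_assoc matrix_mult_matrix_inv)
  then show ?thesis
    by (simp add: matrix_vector_mult_diff_rdistrib algebra_simps)
qed

section \<open>The half-sizes\<close>

lemma decreasing_vector_convergent:
  fixes x :: "nat \<Rightarrow> real ^ 'n"
  assumes dec: "\<And>k. x (Suc k) \<le> x k" and bound: "\<And>k. b \<le> x k"
  obtains l where "x \<longlonglongrightarrow> l" "\<And>k. l \<le> x k"
proof -
  have "\<exists>l. (\<lambda>k. x k $ i) \<longlonglongrightarrow> l \<and> (\<forall>k. l \<le> x k $ i)" for i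
  proof -
    have "decseq (\<lambda>k. x k $ i)"
      using dec by (auto simp: decseq_Suc_iff less_eq_vec_def)
    moreover have "\<forall>k. b $ i \<le> x k $ i"
      using bound by (simp add: less_eq_vec_def)
    ultimately show ?thesis
      by (metis decseq_convergent)
  qed
  then obtain l where l: "\<And>i. (\<lambda>k. x k $ i) \<longlonglongrightarrow> l i" "\<And>i k. l i \<le> x k $ i"
    by metis
  show thesis
    by (rule that[of "\<chi> i. l i"]) (auto intro!: vec_tendstoI simp: l less_eq_vec_def)
qed

text \<open>
  Taking the minimum with \<open>R\<close> does not increase distances, so two solutions satisfy
  \<open>\<bar>w - v\<bar> \<le> \<bar>A (w - v)\<bar> \<le> A \<bar>w - v\<bar>\<close>.
\<close>

lemma capped_fixed_point_unique:
  fixes A :: "real ^ 'n ^ 'n"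
  assumes A: "0 \<le> A" and rho: "spectral_radius A < 1"
    and v: "v = inf R (A *v v + \<xi>)" and w: "w = inf R (A *v w + \<xi>)"
  shows "w = v"
proof -
  have "\<bar>w - v\<bar> \<le> \<bar>A *v (w - v)\<bar>"
    unfolding less_eq_vec_def
  proof
    fix i
    have "w $ i = min (R $ i) ((A *v w) $ i + \<xi> $ i)" "v $ i = min (R $ i) ((A *v v) $ i + \<xi> $ i)"
      using arg_cong[OF w, of "\<lambda>u. u $ i"] arg_cong[OF v, of "\<lambda>u. u $ i"]
      by (simp_all add: inf_vector_nth)
    then show "\<bar>w - v\<bar> $ i \<le> \<bar>A *v (w - v)\<bar> $ i"
      by (simp add: abs_vector_nth matrix_vector_mult_diff_distrib)
  qed
  also have "\<dots> \<le> A *v \<bar>w - v\<bar>"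
    by (rule abs_nonneg_matrix_vector_le[OF A])
  finally have "\<bar>w - v\<bar> = 0"
    by (intro subinvariant_vector_eq_0[OF A rho]) (auto simp: less_eq_vec_def abs_vector_nth)
  then show ?thesis
    by (simp add: vec_eq_iff abs_vector_nth)
qed

locale averaged_capped_iteration =
  fixes A :: "real ^ 'n ^ 'n" and \<xi> R :: "real ^ 'n" and r :: "nat \<Rightarrow> real ^ 'n"
  assumes A_nonneg: "0 \<le> A" and xi_nonneg: "0 \<le> \<xi>" and R_nonneg: "0 \<le> R"
    and r_0: "r 0 = R"
    and r_Suc: "\<And>k. r (Suc k) = (1 / 2) *\<^sub>R (r k + inf (r k) (A *v r k + \<xi>))"
begin

lemma r_Suc_nth: "r (Suc k) $ i = (r k $ i + min (r k $ i) ((A *v r k) $ i + \<xi> $ i)) / 2"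
  by (simp add: r_Suc inf_vector_nth)

lemma r_decreasing: "r (Suc k) \<le> r k"
  by (auto simp: less_eq_vec_def r_Suc_nth)

lemma r_le_start: "r k \<le> R"
  by (induction k) (use r_0 r_decreasing order.trans in auto)

lemma r_nonneg: "0 \<le> r k"
proof (induction k)
  case 0
  then show ?case
    by (simp add: r_0 R_nonneg)
next
  case (Suc k)
  then have "0 \<le> A *v r k"
    by (rule nonneg_matrix_vector_nonneg[OF A_nonneg])
  with Suc xi_nonneg show ?case
    by (simp add: less_eq_vec_def r_Suc_nth)
qed

text \<open>
  The recursion caps at the current \<open>r k\<close>, the fixed point equation at \<open>R\<close>. This invariant
  connects them: a coordinate strictly below \<open>R\<close> is at or above the affine value, so in the limit
  the cap \<open>r k\<close> may be replaced by \<open>R\<close>.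
\<close>

lemma capped_image_le: "inf R (A *v r k + \<xi>) \<le> r k"
proof (induction k)
  case 0
  then show ?case
    by (simp add: r_0)
next
  case (Suc k)
  have "inf R (A *v r (Suc k) + \<xi>) \<le> inf R (A *v r k + \<xi>)"
    by (intro inf_mono order.refl add_right_mono nonneg_matrix_vector_mono A_nonneg r_decreasing)
  also have "\<dots> \<le> inf (r k) (A *v r k + \<xi>)"
    using Suc by simp
  also have "\<dots> \<le> r (Suc k)"
    by (auto simp: less_eq_vec_def r_Suc_nth inf_vector_nth)
  finally show ?case .
qed

lemma r_tendsto_capped_fixed_point:
  obtains v where "r \<longlonglongrightarrow> v" "\<And>k. v \<le> r k" "0 \<le> v" "v = inf R (A *v v + \<xi>)"
proof -
  obtain v where lim: "r \<longlonglongrightarrow> v" and le: "\<And>k. v \<le> r k"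
    using decreasing_vector_convergent[of r 0, OF r_decreasing r_nonneg] by blast
  have lim_i: "(\<lambda>k. r k $ i) \<longlonglongrightarrow> v $ i" for i
    by (intro tendsto_vec_nth lim)
  have lim_A: "(\<lambda>k. (A *v r k) $ i + \<xi> $ i) \<longlonglongrightarrow> (A *v v) $ i + \<xi> $ i" for i
    by (intro tendsto_intros tendsto_vec_nth lim
        bounded_linear.tendsto[OF matrix_vector_mul_bounded_linear])
  have nonneg: "0 \<le> v"
    using LIMSEQ_le_const[OF lim_i] r_nonneg by (simp add: less_eq_vec_def)
  have "v $ i = min (R $ i) ((A *v v) $ i + \<xi> $ i)" for i
  proof (rule antisym)
    have "(\<lambda>k. (r k $ i + min (r k $ i) ((A *v r k) $ i + \<xi> $ i)) / 2)
        \<longlonglongrightarrow> (v $ i + min (v $ i) ((A *v v) $ i + \<xi> $ i)) / 2"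
      by (intro tendsto_intros lim_i lim_A) simp
    moreover have "(\<lambda>k. r (Suc k) $ i) \<longlonglongrightarrow> v $ i"
      by (rule LIMSEQ_Suc[OF lim_i])
    ultimately have "v $ i = (v $ i + min (v $ i) ((A *v v) $ i + \<xi> $ i)) / 2"
      unfolding r_Suc_nth using LIMSEQ_unique by blast
    moreover have "v $ i \<le> R $ i"
      using le[of 0] by (simp add: r_0 less_eq_vec_def)
    ultimately show "v $ i \<le> min (R $ i) ((A *v v) $ i + \<xi> $ i)"
      by (auto simp: min_def field_simps split: if_splits)
    have "(\<lambda>k. min (R $ i) ((A *v r k) $ i + \<xi> $ i)) \<longlonglongrightarrow> min (R $ i) ((A *v v) $ i + \<xi> $ i)"
      by (intro tendsto_intros lim_A)
    moreover have "min (R $ i) ((A *v r k) $ i + \<xi> $ i) \<le> r k $ i" for k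
      using capped_image_le[of k] by (simp add: less_eq_vec_def inf_vector_nth)
    ultimately show "min (R $ i) ((A *v v) $ i + \<xi> $ i) \<le> v $ i"
      by (intro LIMSEQ_le[OF _ lim_i]) auto
  qed
  then have "v = inf R (A *v v + \<xi>)"
    by (simp add: vec_eq_iff inf_vector_nth)
  with that lim le nonneg show thesis
    by blast
qed

text \<open>
  The one-step contraction \<open>r (Suc k) - v \<le> M (r k - v)\<close> with \<open>M = (I + A) / 2\<close> holds in each
  coordinate for one of two reasons: where \<open>v\<close> attains the affine value, by linearity; where
  \<open>v\<close> attains the cap \<open>R\<close>, because \<open>r k\<close> cannot exceed it.
\<close>

lemma error_bound:
  assumes v: "v = inf R (A *v v + \<xi>)" and le: "\<And>k. v \<le> r k"
  shows "r k - v \<le> matrix_power ((1 / 2) *\<^sub>R (mat 1 + A)) k *v (R - v)"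
proof (induction k)
  case 0
  then show ?case
    by (simp add: r_0)
next
  case (Suc k)
  let ?M = "(1 / 2) *\<^sub>R (mat 1 + A)"
  have M: "0 \<le> ?M"
    using A_nonneg by (auto simp: less_eq_vec_def mat_def)
  have M_apply: "?M *v x = (1 / 2) *\<^sub>R (x + A *v x)" for x
    by (simp add: scaleR_matrix_vector_assoc[symmetric] matrix_vector_mult_add_rdistrib)
  have "r (Suc k) - v \<le> ?M *v (r k - v)"
    unfolding less_eq_vec_def
  proof
    fix i
    have "0 \<le> (A *v (r k - v)) $ i"
      using nonneg_matrix_vector_nonneg[OF A_nonneg, of "r k - v"] le[of k]
      by (simp add: less_eq_vec_def)
    moreover have "v $ i = min (R $ i) ((A *v v) $ i + \<xi> $ i)"
      using arg_cong[OF v, of "\<lambda>u. u $ i"] by (simp add: inf_vector_nth)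
    moreover have "r k $ i \<le> R $ i"
      using r_le_start[of k] by (simp add: less_eq_vec_def)
    ultimately show "(r (Suc k) - v) $ i \<le> (?M *v (r k - v)) $ i"
      unfolding M_apply by (auto simp: r_Suc_nth matrix_vector_mult_diff_distrib min_def split: if_splits)
  qed
  also have "\<dots> \<le> ?M *v (matrix_power ?M k *v (R - v))"
    by (rule nonneg_matrix_vector_mono[OF M Suc])
  finally show ?case
    by (simp add: matrix_vector_mul_assoc)
qed

end

section \<open>The centres\<close>

lemma partial_derivative_quadratic:
  fixes H :: "real ^ 'n ^ 'n"
  assumes sym: "transpose H = H"
    and f: "\<And>x. f x = 1 / 2 * ((x - x0) \<bullet> (H *v (x - x0)))"
  shows "partial_derivative i f x = (H *v (x - x0)) $ i"
proof -
  let ?a = "axis i 1 :: real ^ 'n"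
  define e where "e = x - x0"
  have swap: "e \<bullet> (H *v ?a) = ?a \<bullet> (H *v e)"
    by (metis sym dot_lmul_matrix inner_commute transpose_matrix_vector)
  have "f (x + \<tau> *\<^sub>R ?a) = f x + \<tau> * (?a \<bullet> (H *v e)) + \<tau>\<^sup>2 * (?a \<bullet> (H *v ?a)) / 2" for \<tau>
  proof -
    have "x + \<tau> *\<^sub>R ?a - x0 = e + \<tau> *\<^sub>R ?a"
      by (simp add: e_def)
    then show ?thesis
      unfolding f e_def[symmetric]
      by (simp add: inner_add_left inner_add_right matrix_vector_right_distrib swap
          matrix_vector_mult_scaleR power2_eq_square field_simps)
  qed
  then have "((\<lambda>\<tau>. f (x + \<tau> *\<^sub>R ?a)) has_field_derivative ?a \<bullet> (H *v e)) (at 0)"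
    by (simp only:) (auto intro!: derivative_eq_intros)
  then have "partial_derivative i f x = ?a \<bullet> (H *v e)"
    unfolding partial_derivative_def by (rule DERIV_imp_deriv)
  then show ?thesis
    by (simp add: inner_axis' e_def)
qed

lemma diagonal_part_mult_nth:
  "(diagonal_part H ** X) $ i $ j = H $ i $ i * X $ i $ j"
proof -
  have "(diagonal_part H ** X) $ i $ j = (\<Sum>k\<in>UNIV. if i = k then H $ i $ i * X $ k $ j else 0)"
    unfolding matrix_matrix_mult_def diagonal_part_def vec_lambda_beta by (rule sum.cong) auto
  then show ?thesis
    by simp
qed

text \<open>Comparing entries in \<open>D (D\<^sup>-\<^sup>1 N) = N\<close> gives those of \<open>D\<^sup>-\<^sup>1 N\<close> directly.\<close>

lemma jacobi_matrix_nth: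
  fixes H :: "real ^ 'n ^ 'n"
  assumes pos: "\<And>i. H $ i $ i > 0"
  shows "(matrix_inv (diagonal_part H) ** \<bar>H - diagonal_part H\<bar>) $ i $ j
    = (if i = j then 0 else \<bar>H $ i $ j\<bar> / H $ i $ i)"
proof -
  let ?D = "diagonal_part H" and ?N = "\<bar>H - diagonal_part H\<bar>"
  have nz: "H $ i $ i \<noteq> 0" for i
    using pos[of i] by simp
  have "?D ** (\<chi> i j. if i = j then 1 / H $ i $ i else 0) = mat 1"
    using nz by (simp add: vec_eq_iff diagonal_part_mult_nth mat_def)
  then have "invertible ?D"
    unfolding invertible_right_inverse by blast
  then have "?D ** (matrix_inv ?D ** ?N) = ?N"
    by (simp add: matrix_mul_assoc matrix_mult_matrix_inv)
  then have "H $ i $ i * (matrix_inv ?D ** ?N) $ i $ j = ?N $ i $ j"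
    by (metis diagonal_part_mult_nth)
  moreover have "?N $ i $ j = (if i = j then 0 else \<bar>H $ i $ j\<bar>)"
    by (simp add: abs_vec_def diagonal_part_def)
  ultimately show ?thesis
    using nz[of i] by (simp add: eq_divide_eq mult.commute split: if_splits)
qed

text \<open>
  When \<open>\<bar>e\<bar> \<le> r\<close>, the off-diagonal part of \<open>(H e) $ i\<close> is at most \<open>H $ i $ i * (A r) $ i\<close> in absolute value, so
  a bound on \<open>(H e) $ i\<close> from below bounds \<open>e $ i\<close> itself from below.
\<close>

lemma coordinate_lower_bound:
  fixes H A :: "real ^ 'n ^ 'n"
  assumes pos: "H $ i $ i > 0"
    and A: "\<And>j. A $ i $ j = (if i = j then 0 else \<bar>H $ i $ j\<bar> / H $ i $ i)"
    and e: "\<And>j. \<bar>e $ j\<bar> \<le> r $ j"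
    and lower: "- (H $ i $ i * b) \<le> (H *v e) $ i"
  shows "- ((A *v r) $ i + b) \<le> e $ i"
proof -
  have "(H *v e) $ i = H $ i $ i * e $ i + (\<Sum>j\<in>UNIV - {i}. H $ i $ j * e $ j)"
    by (simp add: matrix_vector_nth sum.remove[of UNIV i])
  moreover have "(\<Sum>j\<in>UNIV - {i}. H $ i $ j * e $ j) \<le> (\<Sum>j\<in>UNIV - {i}. \<bar>H $ i $ j\<bar> * r $ j)"
  proof (rule sum_mono)
    fix j
    have "H $ i $ j * e $ j \<le> \<bar>H $ i $ j\<bar> * \<bar>e $ j\<bar>"
      by (metis abs_ge_self abs_mult)
    also have "\<dots> \<le> \<bar>H $ i $ j\<bar> * r $ j"
      by (intro mult_left_mono e) simp
    finally show "H $ i $ j * e $ j \<le> \<bar>H $ i $ j\<bar> * r $ j" .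
  qed
  moreover have "(\<Sum>j\<in>UNIV - {i}. \<bar>H $ i $ j\<bar> * r $ j) = H $ i $ i * (A *v r) $ i"
  proof -
    have "(A *v r) $ i = (\<Sum>j\<in>UNIV - {i}. A $ i $ j * r $ j)"
      by (simp add: matrix_vector_nth sum.remove[of UNIV i] A)
    then show ?thesis
      using pos by (auto simp: sum_distrib_left A intro!: sum.cong)
  qed
  ultimately have "H $ i $ i * (- ((A *v r) $ i + b)) \<le> H $ i $ i * e $ i"
    using lower by (simp add: algebra_simps)
  then show ?thesis
    using pos by simp
qed

text \<open>
  Here \<open>e\<close> is the centre minus the point sought. The new interval, of half-width \<open>(r + t) / 2\<close>,
  is the old one with a piece of length \<open>r - t\<close> cut off on the side to which the sign \<open>s\<close>
  points; the last hypothesis says that the point sought is not in that piece.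
\<close>

lemma sign_step_error:
  fixes e r t s :: real
  assumes "s \<in> {- 1, 1}" "\<bar>e\<bar> \<le> r" "- t \<le> s * e"
  shows "\<bar>e - (r - t) / 2 * s\<bar> \<le> (r + t) / 2"
  using assms by (auto simp: abs_le_iff field_simps)

section \<open>Convergence of the boxes\<close>

theorem corollary4p8:
  fixes H D A :: "real ^ 'n ^ 'n"
    and x_star r_init \<xi> :: "real ^ 'n"
    and f :: "real ^ 'n \<Rightarrow> real"
    and c r t h s g :: "nat \<Rightarrow> real ^ 'n"
  assumes H_sym: "transpose H = H"
    and H_diag: "\<And>i. H $ i $ i > 0"
    and D_eq: "D = diagonal_part H"
    and A_eq: "A = matrix_inv D ** \<bar>H - D\<bar>"
    and A_radius: "spectral_radius A < 1"
    and f_eq: "\<And>x. f x = 1 / 2 * ((x - x_star) \<bullet> (H *v (x - x_star)))"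
    and r_init_pos: "\<And>i. r_init $ i > 0"
    and x_star_in: "x_star \<in> box_around (c 0) r_init"
    and xi_nonneg: "0 \<le> \<xi>"
    and gradient_error:
      "\<And>k i. \<bar>g k $ i - partial_derivative i f (c k)\<bar> \<le> H $ i $ i * \<xi> $ i"
    and r_0: "r 0 = r_init"
    and t_eq: "\<And>k. t k = inf (r k) (A *v r k + \<xi>)"
    and h_eq: "\<And>k. h k = (1 / 2) *\<^sub>R (r k - t k)"
    and r_Suc: "\<And>k. r (Suc k) = (1 / 2) *\<^sub>R (r k + t k)"
    and c_Suc: "\<And>k. c (Suc k) = c k - h k * s k"
    and s_range: "\<And>k i. s k $ i \<in> {- 1, 1}"
    and s_sign: "\<And>k i. g k $ i \<noteq> 0 \<Longrightarrow> s k $ i = sgn (g k $ i)"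
  shows "(\<forall>k. x_star \<in> box_around (c k) (r k) \<and>
              box_around (c (Suc k)) (r (Suc k)) \<subseteq> box_around (c k) (r k)) \<and>
         invertible (mat 1 - A) \<and>
         (\<exists>v. v \<in> {0..r_init} \<and> v = inf r_init (A *v v + \<xi>) \<and>
              (\<forall>w. w \<in> {0..r_init} \<and> w = inf r_init (A *v w + \<xi>) \<longrightarrow> w = v) \<and>
              r \<longlonglongrightarrow> v \<and>
              (\<forall>k. 0 \<le> r k - v \<and>
                   r k - v \<le> matrix_power ((1 / 2) *\<^sub>R (mat 1 + A)) k *v (r_init - v)) \<and>
              v \<le> matrix_inv (mat 1 - A) *v \<xi> \<and>
              (\<exists>c_inf. c \<longlonglongrightarrow> c_inf \<and> \<bar>c_inf - x_star\<bar> \<le> v) \<and>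
              (matrix_inv (mat 1 - A) *v \<xi> \<le> r_init \<longrightarrow> v = matrix_inv (mat 1 - A) *v \<xi>))"
proof -
  have A_nth: "A $ i $ j = (if i = j then 0 else \<bar>H $ i $ j\<bar> / H $ i $ i)" for i j
    unfolding A_eq D_eq by (rule jacobi_matrix_nth[OF H_diag])
  have A_nonneg: "0 \<le> A"
    using H_diag by (auto simp: less_eq_vec_def A_nth intro: divide_nonneg_pos)
  have inv: "invertible (mat 1 - A)"
    by (rule invertible_mat_1_minus[OF A_nonneg A_radius])
  interpret averaged_capped_iteration A \<xi> r_init r
    by unfold_locales
      (use A_nonneg xi_nonneg r_init_pos r_0 r_Suc t_eq in \<open>auto simp: less_eq_vec_def less_imp_le\<close>)

  have t_nth: "t k $ i = min (r k $ i) ((A *v r k) $ i + \<xi> $ i)" for k i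
    by (simp add: t_eq inf_vector_nth)
  have rS: "r (Suc k) $ i = (r k $ i + t k $ i) / 2" for k i
    by (simp add: r_Suc t_eq)
  have cS: "c (Suc k) $ i = c k $ i - (r k $ i - t k $ i) / 2 * s k $ i" for k i
    by (simp add: c_Suc h_eq)
  have c_step: "\<bar>c (Suc k) $ i - c k $ i\<bar> = r k $ i - r (Suc k) $ i" for k i
    using s_range[of k i] t_nth[of k i] by (auto simp: cS rS field_simps)

  have inside: "\<bar>x_star $ i - c k $ i\<bar> \<le> r k $ i" for k i
  proof (induction k arbitrary: i)
    case 0
    then show ?case
      using x_star_in by (simp add: box_around_def r_0)
  next
    case (Suc k)
    define e where "e = c k - x_star"
    have e: "\<bar>e $ j\<bar> \<le> r k $ j" for j
      using Suc[of j] by (simp add: e_def abs_minus_commute)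
    have grad: "\<bar>g k $ i - (H *v e) $ i\<bar> \<le> H $ i $ i * \<xi> $ i"
      using gradient_error[of k i] by (simp add: partial_derivative_quadratic[OF H_sym f_eq] e_def)
    \<comment> \<open>The sign \<open>1\<close> is possible only for \<open>g k $ i \<ge> 0\<close>, hence for
      \<open>(H e) $ i \<ge> - H $ i $ i * \<xi> $ i\<close>; the sign \<open>-1\<close> is the same situation for \<open>-e\<close>.\<close>
    have "- ((A *v r k) $ i + \<xi> $ i) \<le> s k $ i * e $ i"
    proof (cases "s k $ i = 1")
      case True
      then have "0 \<le> g k $ i"
        using s_sign[of k i] by (cases "g k $ i" "0 :: real" rule: linorder_cases) auto
      then have "- ((A *v r k) $ i + \<xi> $ i) \<le> e $ i"
        using grad by (intro coordinate_lower_bound[OF H_diag A_nth e]) linarith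
      then show ?thesis
        using True by simp
    next
      case False
      then have s: "s k $ i = - 1"
        using s_range[of k i] by simp
      then have "g k $ i \<le> 0"
        using s_sign[of k i] by (cases "g k $ i" "0 :: real" rule: linorder_cases) auto
      moreover have "(H *v (- e)) $ i = - (H *v e) $ i"
        by (simp add: matrix_vector_nth sum_negf)
      ultimately have "- ((A *v r k) $ i + \<xi> $ i) \<le> (- e) $ i"
        using grad e by (intro coordinate_lower_bound[OF H_diag A_nth]) (simp, linarith)
      then show ?thesis
        using s by simp
    qed
    moreover have "- r k $ i \<le> s k $ i * e $ i"
      using e[of i] s_range[of k i] by auto
    ultimately have "- t k $ i \<le> s k $ i * e $ i"
      by (simp add: t_nth min_def)
    with s_range e have "\<bar>e $ i - (r k $ i - t k $ i) / 2 * s k $ i\<bar> \<le> (r k $ i + t k $ i) / 2"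
      by (rule sign_step_error)
    then show ?case
      by (simp add: cS rS e_def abs_minus_commute algebra_simps)
  qed

  have nested: "box_around (c (Suc k)) (r (Suc k)) \<subseteq> box_around (c k) (r k)" for k
  proof
    fix x assume x: "x \<in> box_around (c (Suc k)) (r (Suc k))"
    have "\<bar>x $ i - c k $ i\<bar> \<le> r k $ i" for i
    proof -
      have "\<bar>x $ i - c (Suc k) $ i\<bar> \<le> r (Suc k) $ i"
        using x by (simp add: box_around_def)
      then show ?thesis
        using c_step[of k i] by linarith
    qed
    then show "x \<in> box_around (c k) (r k)"
      by (simp add: box_around_def)
  qed

  obtain v where lim: "r \<longlonglongrightarrow> v" and v_le: "\<And>k. v \<le> r k" and v_nonneg: "0 \<le> v"
    and v: "v = inf r_init (A *v v + \<xi>)"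
    using r_tendsto_capped_fixed_point by blast
  have unique: "w = v" if "w = inf r_init (A *v w + \<xi>)" for w
    by (rule capped_fixed_point_unique[OF A_nonneg A_radius v that])
  have v_le_init: "v \<le> r_init"
    using v_le[of 0] by (simp add: r_0)

  define u where "u = matrix_inv (mat 1 - A) *v \<xi>"
  have u: "u = A *v u + \<xi>"
    by (rule matrix_inv_mat_1_minus_eq[OF inv u_def])
  have "v \<le> A *v v + \<xi>"
    by (subst v) simp
  then have "0 \<le> u - v"
    by (intro superinvariant_vector_nonneg[OF A_nonneg A_radius], subst (2) u)
      (simp add: matrix_vector_mult_diff_distrib algebra_simps)
  then have v_le_u: "v \<le> u"
    by simp
  have v_eq_u: "v = u" if "u \<le> r_init"
    using unique[of u] u that by (simp add: inf.absorb2)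

  \<comment> \<open>The upper ends \<open>c k + r k\<close> of the boxes decrease and stay above \<open>x_star\<close>, so they converge;
    hence so do the centres.\<close>
  obtain l where l: "(\<lambda>k. c k + r k) \<longlonglongrightarrow> l"
  proof (rule decreasing_vector_convergent)
    show "c (Suc k) + r (Suc k) \<le> c k + r k" for k
      unfolding less_eq_vec_def
    proof
      show "(c (Suc k) + r (Suc k)) $ i \<le> (c k + r k) $ i" for i
        using c_step[of k i] by simp
    qed
    show "x_star \<le> c k + r k" for k
      unfolding less_eq_vec_def
    proof
      show "x_star $ i \<le> (c k + r k) $ i" for i
        using inside[of i k] by simp
    qed
  qed
  have c_lim: "c \<longlonglongrightarrow> l - v"
    using tendsto_diff[OF l lim] by simp
  have "\<bar>(l - v) $ i - x_star $ i\<bar> \<le> v $ i" for i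
  proof (rule LIMSEQ_le)
    show "(\<lambda>k. \<bar>c k $ i - x_star $ i\<bar>) \<longlonglongrightarrow> \<bar>(l - v) $ i - x_star $ i\<bar>"
      by (intro tendsto_intros tendsto_vec_nth c_lim)
    show "(\<lambda>k. r k $ i) \<longlonglongrightarrow> v $ i"
      by (intro tendsto_vec_nth lim)
    show "\<exists>N. \<forall>k\<ge>N. \<bar>c k $ i - x_star $ i\<bar> \<le> r k $ i"
      using inside[of i] by (simp add: abs_minus_commute)
  qed
  then have centre: "\<bar>(l - v) - x_star\<bar> \<le> v"
    by (simp add: less_eq_vec_def abs_vector_nth)

  have x_star_in_boxes: "x_star \<in> box_around (c k) (r k)" for k
    using inside by (simp add: box_around_def)
  have v_mem: "v \<in> {0..r_init}" and r_diff_nonneg: "0 \<le> r k - v" for k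
    using v_nonneg v_le_init v_le by simp_all
  show ?thesis
    by (intro conjI allI impI exI[of _ v] exI[of _ "l - v"])
      (fact x_star_in_boxes nested inv v_mem v lim r_diff_nonneg error_bound[OF v v_le]
        v_le_u[unfolded u_def] c_lim centre
       | erule v_eq_u[unfolded u_def] | (elim conjE, erule unique))+
qed

end
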